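(* Let $\mathbf u$ be a simple Parry sequence with parameters $m\ge2$, $t_1,\dots,t_m$, and assume (1) $t_i\cdots t_{m-2}(t_{m-1}+1)0^{\omega}\prec_{\mathrm{lex}}t_1t_2\cdots t_m0^{\omega}$ for all $i\in\{2,\dots,m-2\}$; (2) $t_1>\max\{t_{m-1},t_m\}$. Then: (a) for each $n\in\mathbb N$, $n\le m-1$, every prefix of $\mathbf u$ of length $\ell\in[U_n,U_{n+1}-1]$ has the attractor $\Gamma_n$; (b) for each $n\in\mathbb N$, $n\ge m$, every prefix of $\mathbf u$ of length $\ell\in[U_n,Z_n]$ has the attractor $\Gamma_{n-1}$; (c) for each $n\in\mathbb N$, $n\ge m$, every prefix of $\mathbf u$ of length $\ell\in[Z_n,U_{n+1}]$ has the attractor $\Gamma_n$.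
   Context: Simple Parry sequence: $m\in\mathbb N$, $m\ge2$, $t_1,\dots,t_m\in\mathbb N$ with $t_1\ge1$, $t_m\ge1$ and $t_it_{i+1}\cdots t_m0^{\omega}\prec_{\mathrm{lex}}t_1t_2\cdots t_m0^{\omega}$ for each $i\in\{2,\dots,m\}$ ($\prec_{\mathrm{lex}}$ is lexicographic order on integer sequences). $\varphi$ is the morphism on $\{0,\dots,m-1\}^*$ with $\varphi(j)=0^{t_{j+1}}(j+1)$ for $0\le j\le m-2$, $\varphi(m-1)=0^{t_m}$, and $\mathbf u$ is its fixed point starting with $0$. Let $u_n=\varphi^n(0)$, $U_n=|u_n|$ for $n\ge0$, and $u_n=\varepsilon$, $U_n=0$ for $n<0$. Set $\Gamma_n=\{U_0-1,\dots,U_n-1\}$ for $0\le n\le m-1$ and $\Gamma_n=\{U_{n-m+1}-1,\dots,U_n-1\}$ for $n\ge m$. For $n\ge m$, $Z_n=|u_nu_{n-m}^{t_1-t_m}u_{n-m-1}^{t_2}\cdots u_{n-2m+1}^{t_m}|$ (after $u_{n-m}^{t_1-t_m}$ come $u_{n-m-i}^{t_{i+1}}$, $i=1,\dots,m-1$). A (string) attractor of a finite word $w=w_0\cdots w_{N-1}$ is a set $\Gamma\subseteq\{0,\dots,N-1\}$ such that every non-empty factor of $w$ has an occurrence $w_i\cdots w_{j-1}$ with $\{i,\dots,j-1\}\cap\Gamma\ne\emptyset$; positions are indexed from $0$. *)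

theory Defs
  imports Main "HOL-Library.Stream" "HOL-Library.Sublist" "HOL-Library.Fun_Lexorder"
begin

(* The finite word w followed by infinitely many zeros. *)
definition zero_ext :: "nat list \<Rightarrow> nat \<Rightarrow> nat" where
  "zero_ext w = (\<lambda>k. if k < length w then w ! k else 0)"

(* Lexicographic comparison of v 0 0 0 ... with w 0 0 0 .... *)
abbreviation lex_less :: "nat list \<Rightarrow> nat list \<Rightarrow> bool" where
  "lex_less v w \<equiv> less_fun (zero_ext v) (zero_ext w)"

(* Only the values t 1, ..., t m of the parameter function t matter. *)
definition simple_Parry :: "nat \<Rightarrow> (nat \<Rightarrow> nat) \<Rightarrow> bool" where
  "simple_Parry m t \<longleftrightarrow> m \<ge> 2 \<and> t 1 \<ge> 1 \<and> t m \<ge> 1 \<and>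
     (\<forall>i\<in>{2..m}. lex_less (map t [i..<m + 1]) (map t [1..<m + 1]))"

(* On the alphabet {0..<m}; the value on letters j >= m is irrelevant. *)
definition Parry_letter :: "nat \<Rightarrow> (nat \<Rightarrow> nat) \<Rightarrow> nat \<Rightarrow> nat list" where
  "Parry_letter m t j =
     (if j + 1 < m then replicate (t (j + 1)) 0 @ [j + 1] else replicate (t m) 0)"

definition Parry_morphism :: "nat \<Rightarrow> (nat \<Rightarrow> nat) \<Rightarrow> nat list \<Rightarrow> nat list" where
  "Parry_morphism m t w = concat (map (Parry_letter m t) w)"

(* The morphism is non-erasing when t m >= 1, so that "flat" concatenates the images of all
   letters of an infinite word. *)
definition Parry_sequence :: "nat \<Rightarrow> (nat \<Rightarrow> nat) \<Rightarrow> nat stream \<Rightarrow> bool" where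
  "Parry_sequence m t u \<longleftrightarrow>
     sset u \<subseteq> {0..<m} \<and> shd u = 0 \<and> flat (smap (Parry_letter m t) u) = u"

(* Integer indices, because words with negative index occur and are empty. *)
definition uword :: "nat \<Rightarrow> (nat \<Rightarrow> nat) \<Rightarrow> int \<Rightarrow> nat list" where
  "uword m t n = (if n < 0 then [] else (Parry_morphism m t ^^ nat n) [0])"

definition ulen :: "nat \<Rightarrow> (nat \<Rightarrow> nat) \<Rightarrow> int \<Rightarrow> nat" where
  "ulen m t n = length (uword m t n)"

(* For simple Parry parameters no subtraction is truncated: ulen m t i >= 1 for i >= 0. *)
definition Gam :: "nat \<Rightarrow> (nat \<Rightarrow> nat) \<Rightarrow> nat \<Rightarrow> nat set" where
  "Gam m t n =
     (if n \<le> m - 1 then (\<lambda>i. ulen m t (int i) - 1) ` {0..n}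
      else (\<lambda>i. ulen m t (int i) - 1) ` {n - m + 1..n})"

definition word_power :: "'a list \<Rightarrow> nat \<Rightarrow> 'a list" where
  "word_power w k = concat (replicate k w)"

(* For simple Parry parameters t m <= t 1, so that the exponent t 1 - t m is not truncated. *)
definition Zlen :: "nat \<Rightarrow> (nat \<Rightarrow> nat) \<Rightarrow> nat \<Rightarrow> nat" where
  "Zlen m t n = length
     (uword m t (int n) @ word_power (uword m t (int n - int m)) (t 1 - t m) @
      concat (map (\<lambda>i. word_power (uword m t (int n - int m - int i)) (t (i + 1))) [1..<m]))"

definition string_attractor :: "nat set \<Rightarrow> 'a list \<Rightarrow> bool" where
  "string_attractor A w \<longleftrightarrow> A \<subseteq> {0..<length w} \<and>
     (\<forall>v. v \<noteq> [] \<and> sublist v w \<longrightarrow>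
        (\<exists>i j. i \<le> j \<and> j \<le> length w \<and> take (j - i) (drop i w) = v \<and> {i..<j} \<inter> A \<noteq> {}))"

end

theory Submission
  imports Defs
begin

text \<open>If a prefix of \<open>u\<close> has period \<open>p\<close>, then adding \<open>p - 1\<close> to an attractor of any prefix of length
  at least \<open>p - 1\<close> gives an attractor of it. The word \<open>u\<^sub>n = u\<^sub>n\<^sub>-\<^sub>1\<^bsup>t 1\<^esup> \<dots> u\<^sub>n\<^sub>-\<^sub>m\<^bsup>t m\<^esup>\<close> has period
  \<open>U\<^sub>n\<^sub>-\<^sub>1\<close> by the Parry condition, and the prefix of length \<open>Z\<^sub>n\<close>, which is
  \<open>u\<^sub>n\<^sub>-\<^sub>1\<^bsup>t 1\<^esup> \<dots> u\<^sub>n\<^sub>-\<^sub>m\<^sub>+\<^sub>1\<^bsup>t (m - 1) + 1\<^esup>\<close> (without its last letter if \<open>n < 2 m - 1\<close>), still has this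
  period by condition (1). At length \<open>Z\<^sub>n\<close> the position \<open>U\<^sub>n\<^sub>-\<^sub>m - 1\<close> of the attractor can be exchanged
  for \<open>U\<^sub>n - 1\<close>: the last \<open>u\<^sub>n\<^sub>-\<^sub>m\<^sub>+\<^sub>1\<close> has period \<open>U\<^sub>n\<^sub>-\<^sub>m\<close>, and \<open>U\<^sub>n - 1\<close> is the end of its \<open>t m\<close>-th period.\<close>

section \<open>Periods and string attractors of prefixes\<close>

text \<open>Naming factors by positions lets occurrences be compared letter by letter in the
  infinite word and moved by index arithmetic.\<close>

lemma string_attractor_stake_iff:
  "string_attractor A (stake l s) \<longleftrightarrow> A \<subseteq> {0..<l} \<and>
     (\<forall>i j. i < j \<and> j \<le> l \<longrightarrow>
        (\<exists>i'. i' + (j - i) \<le> l \<and> (\<forall>k<j - i. s !! (i' + k) = s !! (i + k)) \<and>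
              {i'..<i' + (j - i)} \<inter> A \<noteq> {}))"
proof -
  have factor: "take (j - i) (drop i (stake l s)) = stake (j - i) (sdrop i s)"
    if "i \<le> j" "j \<le> l" for i j
    using that by (simp add: drop_stake take_stake)
  have eq: "stake d (sdrop i' s) = stake d (sdrop i s) \<longleftrightarrow> (\<forall>k<d. s !! (i' + k) = s !! (i + k))"
    for d i i'
    by (auto simp: list_eq_iff_nth_eq sdrop_snth add.commute)
  show ?thesis
  proof (intro iffI conjI allI impI)
    assume "string_attractor A (stake l s)"
    then show "A \<subseteq> {0..<l}" by (simp add: string_attractor_def)
  next
    fix i j assume attr: "string_attractor A (stake l s)" and ij: "i < j \<and> j \<le> l"
    have "sublist (take (j - i) (drop i (stake l s))) (stake l s)"
      by (metis append_take_drop_id sublist_appendI)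
    moreover have "take (j - i) (drop i (stake l s)) \<noteq> []" using ij by simp
    ultimately obtain i' j' where h: "i' \<le> j'" "j' \<le> l" "{i'..<j'} \<inter> A \<noteq> {}"
      "take (j' - i') (drop i' (stake l s)) = take (j - i) (drop i (stake l s))"
      using attr unfolding string_attractor_def by (metis length_stake)
    then have e: "stake (j' - i') (sdrop i' s) = stake (j - i) (sdrop i s)"
      using factor ij by simp
    then have "j' - i' = j - i" by (metis length_stake)
    then show "\<exists>i'. i' + (j - i) \<le> l \<and> (\<forall>k<j - i. s !! (i' + k) = s !! (i + k)) \<and>
              {i'..<i' + (j - i)} \<inter> A \<noteq> {}"
    proof (intro exI[of _ i'] conjI)
      have "j' = i' + (j - i)" using h(1) \<open>j' - i' = j - i\<close> by linarith
      then show "i' + (j - i) \<le> l" "{i'..<i' + (j - i)} \<inter> A \<noteq> {}" using h by simp_all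
      show "\<forall>k<j - i. s !! (i' + k) = s !! (i + k)"
        using e eq \<open>j' - i' = j - i\<close> by simp
    qed
  next
    assume R: "A \<subseteq> {0..<l} \<and>
     (\<forall>i j. i < j \<and> j \<le> l \<longrightarrow>
        (\<exists>i'. i' + (j - i) \<le> l \<and> (\<forall>k<j - i. s !! (i' + k) = s !! (i + k)) \<and>
              {i'..<i' + (j - i)} \<inter> A \<noteq> {}))"
    show "string_attractor A (stake l s)"
      unfolding string_attractor_def
    proof (intro conjI allI impI)
      show "A \<subseteq> {0..<length (stake l s)}" using R by simp
    next
      fix v :: "'a list" assume v: "v \<noteq> [] \<and> sublist v (stake l s)"
      then obtain p q where pq: "stake l s = p @ v @ q" by (auto simp: sublist_def)
      define i j where "i = length p" and "j = length p + length v"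
      have len: "l = length p + length v + length q"
        using arg_cong[OF pq, of length] by simp
      have ij: "i < j" "j \<le> l" using v len by (auto simp: i_def j_def)
      have v_eq: "v = take (j - i) (drop i (stake l s))" by (simp add: i_def j_def pq)
      obtain i' where i': "i' + (j - i) \<le> l" "\<forall>k<j - i. s !! (i' + k) = s !! (i + k)"
        "{i'..<i' + (j - i)} \<inter> A \<noteq> {}"
        using R ij by blast
      have "take (i' + (j - i) - i') (drop i' (stake l s)) = v"
        using factor[of i' "i' + (j - i)"] factor[of i j] i' ij v_eq eq by simp
      then show "\<exists>i j. i \<le> j \<and> j \<le> length (stake l s) \<and>
          take (j - i) (drop i (stake l s)) = v \<and> {i..<j} \<inter> A \<noteq> {}"
        using i' by (intro exI[of _ i'] exI[of _ "i' + (j - i)"]) auto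
    qed
  qed
qed

definition prefix_period :: "'a stream \<Rightarrow> nat \<Rightarrow> nat \<Rightarrow> bool" where
  "prefix_period s p l \<longleftrightarrow> (\<forall>i. i + p < l \<longrightarrow> s !! (i + p) = s !! i)"

lemma prefix_period_mult:
  assumes "prefix_period s p l" "i + k * p < l"
  shows "s !! (i + k * p) = s !! i"
  using assms(2)
proof (induction k)
  case (Suc k)
  have "i + k * p + p < l" using Suc.prems by (simp add: algebra_simps)
  then have "s !! (i + k * p + p) = s !! (i + k * p)"
    using assms(1) by (simp add: prefix_period_def)
  with Suc show ?case by (simp add: algebra_simps)
qed simp

lemma prefix_period_mono:
  "prefix_period s p l \<Longrightarrow> l' \<le> l \<Longrightarrow> prefix_period s p l'"
  by (auto simp: prefix_period_def)

text \<open>The leftmost occurrence of a factor starts inside the first period, so it either covers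
  position \<open>p - 1\<close> or lies in the prefix of length \<open>p - 1\<close>.\<close>

lemma string_attractor_extend_period:
  assumes attr: "string_attractor A (stake x s)" and per: "prefix_period s p y"
    and p: "p \<ge> 1" "p - 1 \<le> x" "x \<le> y" "p \<le> y"
  shows "string_attractor (insert (p - 1) A) (stake y s)"
  unfolding string_attractor_stake_iff
proof (intro conjI allI impI)
  show "insert (p - 1) A \<subseteq> {0..<y}"
    using attr p unfolding string_attractor_stake_iff by fastforce
next
  fix i j assume ij: "i < j \<and> j \<le> y"
  define i0 where "i0 = i mod p"
  have i0: "i = i0 + (i div p) * p" "i0 < p" using p by (simp_all add: i0_def)
  have same: "s !! (i0 + k) = s !! (i + k)" if "k < j - i" for k
  proof -
    have "i + k = (i0 + k) + (i div p) * p" using i0(1) by linarith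
    moreover have "i + k < y" using that ij by linarith
    ultimately show ?thesis using prefix_period_mult[OF per, of "i0 + k" "i div p"] by metis
  qed
  have bnd: "i0 + (j - i) \<le> y" using i0(1) ij by linarith
  show "\<exists>i'. i' + (j - i) \<le> y \<and> (\<forall>k<j - i. s !! (i' + k) = s !! (i + k)) \<and>
              {i'..<i' + (j - i)} \<inter> insert (p - 1) A \<noteq> {}"
  proof (cases "i0 + (j - i) \<ge> p")
    case True
    then have "p - 1 \<in> {i0..<i0 + (j - i)}" using i0 p by auto
    then show ?thesis using same bnd by blast
  next
    case False
    then have "i0 < i0 + (j - i) \<and> i0 + (j - i) \<le> x" using ij p by auto
    then obtain i' where "i' + (j - i) \<le> x" "\<forall>k<j - i. s !! (i' + k) = s !! (i0 + k)"
      "{i'..<i' + (j - i)} \<inter> A \<noteq> {}"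
      using attr unfolding string_attractor_stake_iff by (metis add_diff_cancel_left')
    then show ?thesis using same p by (intro exI[of _ i']) auto
  qed
qed

text \<open>The prefix of length \<open>d\<close> recurs as the suffix of the prefix of length \<open>z\<close>, with position
  \<open>r * p - 1\<close> moving to \<open>b - 1\<close>. An occurrence that meets \<open>A\<close> only in \<open>p - 1\<close> and avoids \<open>c\<close>
  lies in the prefix of length \<open>d\<close>; translating it by a multiple of \<open>p\<close> makes it cover
  \<open>r * p - 1\<close>.\<close>

lemma string_attractor_exchange:
  assumes attr: "string_attractor A (stake z s)"
    and A: "A \<subseteq> insert (p - 1) B" "c \<in> B" "b - 1 \<in> B" "B \<subseteq> {0..<z}"
    and per: "prefix_period s p d" and p: "p \<ge> 1" "p \<le> c" "c \<le> d" "(r + 1) * p \<le> d" "r \<ge> 1"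
    and shift: "\<And>i. i < d \<Longrightarrow> s !! (b - r * p + i) = s !! i" "r * p \<le> b" "b - r * p + d \<le> z"
  shows "string_attractor B (stake z s)"
  unfolding string_attractor_stake_iff
proof (intro conjI allI impI)
  show "B \<subseteq> {0..<z}" by fact
next
  fix i j assume ij: "i < j \<and> j \<le> z"
  obtain i1 where i1: "i1 + (j - i) \<le> z" "\<forall>k<j - i. s !! (i1 + k) = s !! (i + k)"
      "{i1..<i1 + (j - i)} \<inter> A \<noteq> {}"
    using attr ij unfolding string_attractor_stake_iff by blast
  define e where "e = i1 + (j - i)"
  show "\<exists>i'. i' + (j - i) \<le> z \<and> (\<forall>k<j - i. s !! (i' + k) = s !! (i + k)) \<and>
              {i'..<i' + (j - i)} \<inter> B \<noteq> {}"
  proof (cases "{i1..<e} \<inter> B = {}")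
    case False
    then show ?thesis using i1 by (auto simp: e_def)
  next
    case True
    then have "p - 1 \<in> {i1..<e}" using i1(3) A(1) by (auto simp: e_def)
    then have start: "i1 \<le> p - 1" "p \<le> e" using p by auto
    have "e \<le> c" using True A(2) start(1) p(1,2)
      by (metis IntI atLeastLessThan_iff diff_le_self empty_iff le_trans not_le)
    then have ed: "e \<le> d" using p by simp
    \<comment> \<open>Number of periods that moves the end \<open>e\<close> to at least
      \<open>r * p\<close>; truncation makes it 0 if \<open>e div p\<close> already reaches
      \<open>r\<close>.\<close>
    define k0 where "k0 = r - e div p"
    have q: "1 \<le> e div p" using start(2) p(1) by (simp add: div_greater_zero_iff Suc_le_eq)
    have e_split: "e = e div p * p + e mod p" "e mod p < p" using p(1) by auto
    \<comment> \<open>A moved end is \<open>r * p + e mod p\<close>, below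
      \<open>(r + 1) * p \<le> d\<close>; as \<open>k0 \<le> r - 1\<close>, the start stays at most
      \<open>r * p - 1\<close>.\<close>
    have moved: "e + k0 * p \<le> d" "r * p \<le> e + k0 * p" "i1 + k0 * p \<le> r * p - 1"
    proof -
      have "k0 + e div p = r \<or> k0 = 0 \<and> r \<le> e div p" by (auto simp: k0_def)
      then have "k0 * p + e div p * p = r * p \<or> k0 * p = 0 \<and> r * p \<le> e div p * p"
        by (metis add_mult_distrib mult_le_mono1 mult_0)
      moreover have "r * p + p \<le> d" using p(4) by simp
      ultimately have "e + k0 * p \<le> d \<and> r * p \<le> e + k0 * p"
        using e_split ed by linarith
      then show "e + k0 * p \<le> d" "r * p \<le> e + k0 * p" by simp_all
      have "k0 \<le> r - 1" using q by (simp add: k0_def)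
      then have "k0 * p \<le> (r - 1) * p" by (rule mult_le_mono1)
      moreover have "(r - 1) * p + p = r * p" using p(5) by (cases r) auto
      ultimately show "i1 + k0 * p \<le> r * p - 1" using start(1) p(1) by linarith
    qed
    define i' where "i' = b - r * p + (i1 + k0 * p)"
    have "s !! (i' + k) = s !! (i + k)" if "k < j - i" for k
    proof -
      have "i1 + k + k0 * p < d" using that moved by (simp add: e_def)
      then have "s !! (i' + k) = s !! (i1 + k)"
        using shift(1)[of "i1 + k + k0 * p"] prefix_period_mult[OF per, of "i1 + k" k0]
        by (simp add: i'_def algebra_simps)
      then show ?thesis using i1 that by simp
    qed
    moreover have "i' + (j - i) \<le> z" using moved(1) shift(3) by (simp add: i'_def e_def)
    moreover have "b - 1 \<in> {i'..<i' + (j - i)}"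
    proof -
      have "r * p \<ge> 1" using p by simp
      then show ?thesis using moved shift(2) unfolding i'_def e_def atLeastLessThan_iff by linarith
    qed
    ultimately show ?thesis using A(3) by blast
  qed
qed

section \<open>Expansions of the words of a simple Parry sequence\<close>

text \<open>Digits of a numeration system with base \<open>U\<close>, most significant first, turned
  into words: u_{k-1}^{a_1} u_{k-2}^{a_2} ... . Words of negative index are empty, so digits past
  index 0 add nothing.\<close>

primrec expansion_word :: "nat \<Rightarrow> (nat \<Rightarrow> nat) \<Rightarrow> int \<Rightarrow> nat list \<Rightarrow> nat list" where
  "expansion_word m t k [] = []"
| "expansion_word m t k (a # as) =
     word_power (uword m t (k - 1)) a @ expansion_word m t (k - 1) as"

lemma word_power_simps [simp]:
  "word_power w 0 = []" "word_power w (Suc a) = w @ word_power w a" "word_power [] a = []"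
  by (simp_all add: word_power_def)

lemma word_power_add: "word_power w (a + b) = word_power w a @ word_power w b"
  by (simp add: word_power_def replicate_add)

lemma word_power_Suc_right: "word_power w (Suc a) = word_power w a @ w"
  using word_power_add[of w a 1] by simp

lemma length_word_power [simp]: "length (word_power w a) = a * length w"
  by (induction a) simp_all

lemma word_power_singleton: "word_power [x] a = replicate a x"
  by (induction a) simp_all

lemma prefix_word_power: "a \<le> b \<Longrightarrow> prefix (word_power w a) (word_power w b)"
  by (metis le_add_diff_inverse prefixI word_power_add)

lemma uword_neg [simp]: "k < 0 \<Longrightarrow> uword m t k = []"
  by (simp add: uword_def)

lemma expansion_word_append:
  "expansion_word m t k (as @ bs) =
     expansion_word m t k as @ expansion_word m t (k - int (length as)) bs"
  by (induction as arbitrary: k) (simp_all add: algebra_simps)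

lemma expansion_word_nonpos: "k \<le> 0 \<Longrightarrow> expansion_word m t k as = []"
  by (induction as arbitrary: k) simp_all

lemma expansion_word_replicate_0: "expansion_word m t k (replicate n 0) = []"
  by (induction n arbitrary: k) simp_all

lemma expansion_word_map:
  "expansion_word m t k (map f [0..<n]) =
     concat (map (\<lambda>i. word_power (uword m t (k - 1 - int i)) (f i)) [0..<n])"
  by (induction n) (simp_all add: expansion_word_append algebra_simps)

lemma Parry_morphism_append [simp]:
  "Parry_morphism m t (v @ w) = Parry_morphism m t v @ Parry_morphism m t w"
  by (simp add: Parry_morphism_def)

lemma Parry_morphism_Nil [simp]: "Parry_morphism m t [] = []"
  by (simp add: Parry_morphism_def)

lemma Parry_morphism_power:
  "Parry_morphism m t (word_power w a) = word_power (Parry_morphism m t w) a"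
  by (induction a) simp_all

lemma uword_succ: "0 \<le> k \<Longrightarrow> uword m t (k + 1) = Parry_morphism m t (uword m t k)"
  by (simp add: uword_def nat_add_distrib)

text \<open>The morphism raises every index by one. The bound keeps all indices non-negative: the
  empty word of index -1 is not mapped to \<open>[0]\<close>.\<close>

lemma Parry_morphism_expansion_word:
  "int (length as) \<le> k \<Longrightarrow>
     Parry_morphism m t (expansion_word m t k as) = expansion_word m t (k + 1) as"
proof (induction as arbitrary: k)
  case (Cons a as)
  then show ?case using uword_succ[of "k - 1" m t] Cons.IH[of "k - 1"]
    by (simp add: Parry_morphism_power)
qed simp

declare upt_Suc [simp del]

locale simple_Parry_params =
  fixes m :: nat and t :: "nat \<Rightarrow> nat"
  assumes simple_Parry: "simple_Parry m t"
begin

abbreviation params :: "nat list" where "params \<equiv> map t [1..<m + 1]"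

abbreviation "\<phi> \<equiv> Parry_morphism m t"
abbreviation "w \<equiv> uword m t"
abbreviation "U \<equiv> ulen m t"
abbreviation "E \<equiv> expansion_word m t"

lemma m_ge_2: "m \<ge> 2" and t_1_pos: "t 1 \<ge> 1" and t_m_pos: "t m \<ge> 1"
  using simple_Parry by (auto simp: simple_Parry_def)

lemma params_Cons: "params = t 1 # map t [2..<m + 1]"
  using m_ge_2 by (simp add: upt_conv_Cons numeral_2_eq_2)

lemma params_snoc: "params = map t [1..<m] @ [t m]"
  using m_ge_2 by (simp add: upt_Suc)

lemma params_split: "j < m \<Longrightarrow> params = take j params @ t (j + 1) # drop (j + 1) params"
  using id_take_nth_drop[of j params] by simp

text \<open>The trailing letter creates the new digit: the image of \<open>k\<close> is u_0^{t (k +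
  1)}, followed by the letter \<open>k + 1\<close>, or by nothing if
  \<open>k + 1 = m\<close>.\<close>

lemma uword_initial:
  "k \<le> m \<Longrightarrow> w (int k) = E (int k) (take k params) @ (if k < m then [k] else [])"
proof (induction k)
  case 0
  then show ?case using m_ge_2 by (simp add: uword_def)
next
  case (Suc k)
  have "w (int (Suc k)) = \<phi> (w (int k))"
    using uword_succ[of "int k" m t] by (simp add: add.commute)
  also have "\<dots> = E (int (Suc k)) (take k params) @ \<phi> [k]"
    using Suc Parry_morphism_expansion_word[of "take k params" "int k" m t]
    by (simp add: add.commute min_def)
  also have "\<phi> [k] = word_power (w 0) (t (k + 1)) @ (if Suc k < m then [Suc k] else [])"
  proof (cases "Suc k < m")
    case False
    then have "m = Suc k" using Suc.prems by simp
    then show ?thesis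
      by (simp add: Parry_morphism_def Parry_letter_def uword_def word_power_singleton)
  qed (simp add: Parry_morphism_def Parry_letter_def uword_def word_power_singleton)
  also have "word_power (w 0) (t (k + 1)) = E (int (Suc k) - int (length (take k params))) [t (k + 1)]"
    using Suc.prems by simp
  also have "E (int (Suc k)) (take k params) @ E (int (Suc k) - int (length (take k params))) [t (k + 1)]
      @ (if Suc k < m then [Suc k] else []) =
      E (int (Suc k)) (take (Suc k) params) @ (if Suc k < m then [Suc k] else [])"
    using Suc.prems expansion_word_append[of m t "int (Suc k)" "take k params" "[t (k + 1)]"]
    by (simp add: take_Suc_conv_app_nth)
  finally show ?case by simp
qed

lemma uword_late: "w (int (m + k)) = E (int (m + k)) params"
proof (induction k)
  case 0
  show ?case using uword_initial[of m] by simp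
next
  case (Suc k)
  have "w (int (m + Suc k)) = \<phi> (w (int (m + k)))"
    using uword_succ[of "int (m + k)" m t] by (simp add: add.commute add.left_commute)
  then show ?case
    using Suc Parry_morphism_expansion_word[of params "int (m + k)" m t]
    by (simp add: add.commute add.left_commute)
qed

lemma uword_eq: "w k = E k params @ (if 0 \<le> k \<and> k < int m then [nat k] else [])"
proof -
  consider "k < 0" | "0 \<le> k" "k < int m" | "int m \<le> k" by linarith
  then show ?thesis
  proof cases
    case 1
    then show ?thesis by (simp add: expansion_word_nonpos)
  next
    case 2
    have "E k params = E k (take (nat k) params) @ E (k - int (nat k)) (drop (nat k) params)"
      using 2 expansion_word_append[of m t k "take (nat k) params" "drop (nat k) params"]
      by (simp)
    then show ?thesis using 2 uword_initial[of "nat k"] by (simp add: expansion_word_nonpos)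
  next
    case 3
    then show ?thesis using uword_late[of "nat k - m"] by simp
  qed
qed

lemma prefix_expansion_uword: "prefix (E k params) (w k)"
  by (subst uword_eq) simp

text \<open>At the first difference with the parameters, the remaining expansion is absorbed by one more
  copy of the word at that place.\<close>

lemma prefix_expansion_lex_less:
  assumes "\<And>i. i < length as \<Longrightarrow> lex_less (drop i as) params"
  shows "prefix (E k as) (w k)"
  using assms
proof (induction "length as" arbitrary: as k rule: less_induct)
  case less
  show ?case
  proof (cases "as = []")
    case False
    then have "lex_less as params" using less.prems[of 0] by simp
    then obtain j where j: "zero_ext as j < zero_ext params j"
      "\<And>i. i < j \<Longrightarrow> zero_ext as i = zero_ext params i"
      by (auto elim: less_funE)
    \<comment> \<open>A strict inequality needs a nonzero entry of \<open>params\<close>, hence a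
      position inside that list.\<close>
    have jm: "j < m" using j(1) by (auto simp: zero_ext_def split: if_splits)
    have nth: "params ! i = t (i + 1)" if "i < m" for i using that by (simp)
    have len: "length params = m" by simp
    show ?thesis
    proof (cases "j < length as")
      case True
      have "take j as = take j params"
        using j True jm len by (intro nth_equalityI) (auto simp: zero_ext_def)
      then have as: "as = take j params @ as ! j # drop (j + 1) as"
        using id_take_nth_drop[OF True] by simp
      have aj: "as ! j < t (j + 1)" using j(1) True jm nth len by (simp add: zero_ext_def)
      have "prefix (E (k - int j - 1) (drop (j + 1) as)) (w (k - int j - 1))"
        using True less.prems by (intro less.hyps) (auto simp: less_diff_conv add.commute)
      then have "prefix (word_power (w (k - int j - 1)) (as ! j) @ E (k - int j - 1) (drop (j + 1) as))
          (word_power (w (k - int j - 1)) (Suc (as ! j)))"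
        by (subst word_power_Suc_right) simp
      also have "prefix \<dots> (word_power (w (k - int j - 1)) (t (j + 1)))"
        using aj by (intro prefix_word_power) simp
      finally have "prefix (E k (take j params @ as ! j # drop (j + 1) as))
          (E k (take j params @ t (j + 1) # drop (j + 1) params))"
        using jm unfolding expansion_word_append by (simp add: min_def)
      then have "prefix (E k as) (E k params)" using as params_split[OF jm] by metis
      then show ?thesis using prefix_expansion_uword prefix_order.trans by blast
    next
      case False
      \<comment> \<open>Here \<open>as\<close> ends before the difference; \<open>zero_ext\<close>
        continues it by zeros, which add no word.\<close>
      define z where "z = as @ replicate (j - length as) 0"
      have "z ! i = zero_ext as i" if "i < length z" for i
        using that by (simp add: z_def zero_ext_def nth_append)
      then have "z = take j params"
        using j(2) False jm len
        by (intro nth_equalityI) (simp_all add: z_def zero_ext_def)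
      then have "E k params = E k z @ E (k - int (length z)) (drop j params)"
        by (metis append_take_drop_id expansion_word_append)
      moreover have "E k z = E k as"
        by (simp add: z_def expansion_word_append expansion_word_replicate_0)
      ultimately show ?thesis
        using prefix_expansion_uword[of k] by (metis prefixI prefix_order.trans)
    qed
  qed simp
qed

lemma lex_less_params_suffix:
  assumes "i < m - 1" shows "lex_less (drop i (map t [2..<m + 1])) params"
proof -
  have "drop i (map t [2..<m + 1]) = map t [i + 2..<m + 1]"
    by (simp add: drop_map add.commute)
  then show ?thesis using assms simple_Parry by (auto simp: simple_Parry_def)
qed

lemma lex_less_params_hd:
  assumes "a < t 1" shows "lex_less (a # as) params"
  using assms params_Cons unfolding less_fun_def
  by (intro exI[of _ 0]) (auto simp: zero_ext_def)

text \<open>What follows u_k^{t 1} in the expansion of u_{k+1} starts u_k again; this is the source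
  of the period \<open>U k\<close>.\<close>

lemma prefix_expansion_tail: "prefix (E k (map t [2..<m + 1])) (w k)"
  using lex_less_params_suffix by (intro prefix_expansion_lex_less) simp

lemma length_expansion_params:
  "U k = length (E k params) + (if 0 \<le> k \<and> k < int m then 1 else 0)"
  unfolding ulen_def by (subst uword_eq) simp

lemma expansion_params_Cons:
  "E k params = word_power (w (k - 1)) (t 1) @ E (k - 1) (map t [2..<m + 1])"
  by (subst params_Cons) simp

lemma U_step: "t 1 * U k \<le> U (k + 1)"
  unfolding length_expansion_params[of "k + 1"] expansion_params_Cons by (simp add: ulen_def)

lemma U_mono: "k \<le> l \<Longrightarrow> U k \<le> U l"
proof (induction l rule: int_ge_induct)
  case (step l)
  then show ?case using U_step[of l] t_1_pos
    by (metis le_trans mult_le_mono1 nat_mult_1)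
qed simp

lemma U_pos: "0 \<le> k \<Longrightarrow> 1 \<le> U k"
  using U_mono[of 0 k] by (simp add: ulen_def uword_def)

end

section \<open>Prefixes of the infinite word and their periods\<close>

locale simple_Parry_sequence = simple_Parry_params +
  fixes u :: "nat stream"
  assumes Parry_sequence: "Parry_sequence m t u"
begin

definition is_prefix :: "nat list \<Rightarrow> bool" where
  "is_prefix v \<longleftrightarrow> (\<exists>s. u = v @- s)"

lemma is_prefix_nth: "is_prefix v \<Longrightarrow> i < length v \<Longrightarrow> u !! i = v ! i"
  by (auto simp: is_prefix_def)

lemma is_prefix_prefix: "is_prefix v \<Longrightarrow> prefix v' v \<Longrightarrow> is_prefix v'"
  by (auto simp: is_prefix_def prefix_def)

lemma is_prefix_morphism:
  assumes "is_prefix v" shows "is_prefix (\<phi> v)"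
proof -
  \<comment> \<open>\<open>flat\<close> splits off the image of a letter only if it is nonempty; for
    the letter \<open>m - 1\<close> this is \<open>t m \<ge> 1\<close>.\<close>
  have nonempty: "Parry_letter m t j \<noteq> []" for j
    using t_m_pos by (simp add: Parry_letter_def)
  have "flat (smap (Parry_letter m t) (v @- s)) = \<phi> v @- flat (smap (Parry_letter m t) s)" for s
    by (induction v) (simp_all add: nonempty Parry_morphism_def)
  then show ?thesis
    using assms Parry_sequence by (metis Parry_sequence_def is_prefix_def)
qed

lemma is_prefix_uword: "is_prefix (w (int k))"
proof (induction k)
  case 0
  have "u = [0] @- stl u" using Parry_sequence
    by (metis Parry_sequence_def shift.simps stream.collapse)
  then show ?case by (auto simp: uword_def is_prefix_def)
next
  case (Suc k)
  then show ?case using is_prefix_morphism uword_succ[of "int k" m t] by (simp add: add.commute)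
qed

lemma is_prefix_expansion: "is_prefix (E (int k) params)"
  using is_prefix_uword prefix_expansion_uword is_prefix_prefix by blast

lemma prefix_period_append:
  assumes "is_prefix (z @ y)" "prefix y (z @ y)"
  shows "prefix_period u (length z) (length (z @ y))"
  unfolding prefix_period_def
proof (intro allI impI)
  fix i assume i: "i + length z < length (z @ y)"
  then have "u !! (i + length z) = y ! i"
    using is_prefix_nth[OF assms(1) i] by (simp add: nth_append)
  also have "\<dots> = u !! i"
    using i is_prefix_nth[OF is_prefix_prefix[OF assms]] by simp
  finally show "u !! (i + length z) = u !! i" .
qed

lemma prefix_period_power:
  assumes "is_prefix (word_power z a @ y)" "prefix y z" "a \<ge> 1"
  shows "prefix_period u (length z) (length (word_power z a @ y))"
proof -
  obtain b where b: "a = Suc b" using assms(3) by (cases a) auto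
  have "prefix (word_power z b @ y) (word_power z (Suc b))"
    using assms(2) unfolding word_power_Suc_right by simp
  then have "prefix (word_power z b @ y) (z @ word_power z b @ y)"
    by (metis append.assoc prefix_order.trans prefixI word_power_simps(2))
  then show ?thesis using prefix_period_append[of z "word_power z b @ y"] assms(1) b by simp
qed

text \<open>For \<open>k + 1 < m\<close> the expansion stops just before the last letter of u_{k+1},
  a new letter that would break the period.\<close>

lemma period_expansion_params:
  "prefix_period u (U (int k)) (length (E (int k + 1) params))"
  using is_prefix_expansion[of "k + 1"] prefix_expansion_tail[of "int k"] t_1_pos
    prefix_period_power[of "w (int k)" "t 1" "E (int k) (map t [2..<m + 1])"]
  unfolding expansion_params_Cons by (simp add: ulen_def add.commute)

end

section \<open>Conditions (1) and (2), and attractors of prefixes of length at most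
  \<open>U m\<close>\<close>

locale Parry_attractor = simple_Parry_sequence +
  assumes lex_condition: "\<And>i. i \<in> {2..m - 2} \<Longrightarrow>
      lex_less (map t [i..<m - 1] @ [t (m - 1) + 1]) params"
    and t_1_greater: "t 1 > max (t (m - 1)) (t m)"
begin

lemma m_ge_3: "m \<ge> 3"
  using m_ge_2 t_1_greater by (cases "m = 2") auto

lemma U_double: "2 * U k \<le> U (k + 1)"
proof -
  have "2 \<le> t 1" using t_1_greater t_m_pos by linarith
  then show ?thesis using U_step[of k] by (meson le_trans mult_le_mono1)
qed

lemma U_less: "0 \<le> k \<Longrightarrow> U k < U (k + 1)"
  using U_double[of k] U_pos[of k] by linarith

text \<open>The period \<open>U n\<close> adds the position \<open>U n - 1\<close>. Starting at
  length \<open>U n - 1\<close> suffices, so the new letter ending u_n for \<open>n < m\<close> is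
  first covered by the added position itself.\<close>

lemma attractor_initial_aux:
  assumes "string_attractor ((\<lambda>i. U (int i) - 1) ` {..<n}) (stake (U (int n) - 1) u)"
    and l: "l \<in> {U (int n)..length (E (int n + 1) params)}"
  shows "string_attractor ((\<lambda>i. U (int i) - 1) ` {..n}) (stake l u)"
proof -
  have "prefix_period u (U (int n)) l"
    using prefix_period_mono[OF period_expansion_params[of n]] l by simp
  moreover have "U (int n) - 1 \<le> l" "U (int n) \<le> l" "1 \<le> U (int n)"
    using l U_pos[of "int n"] by auto
  ultimately show ?thesis
    using string_attractor_extend_period[OF assms(1), of "U (int n)" l]
    by (simp add: lessThan_Suc_atMost[symmetric] lessThan_Suc)
qed

lemma attractor_initial:
  assumes "n < m" "l \<in> {U (int n)..length (E (int n + 1) params)}"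
  shows "string_attractor ((\<lambda>i. U (int i) - 1) ` {..n}) (stake l u)"
proof (rule attractor_initial_aux[OF _ assms(2)])
  have "n \<le> m" using assms by simp
  then show "string_attractor ((\<lambda>i. U (int i) - 1) ` {..<n}) (stake (U (int n) - 1) u)"
  proof (induction n)
    case 0
    show ?case by (simp add: ulen_def uword_def string_attractor_def)
  next
    case (Suc n)
    have "U (int (Suc n)) - 1 \<in> {U (int n)..length (E (int n + 1) params)}"
      using U_less[of "int n"] length_expansion_params[of "int n + 1"]
      by (auto simp: add.commute split: if_splits)
    then show ?case
      using attractor_initial_aux[of n "U (int (Suc n)) - 1"] Suc
      by (simp add: lessThan_Suc_atMost)
  qed
qed

section \<open>The prefix of length Z_n and its period\<close>

lemma prefix_uword_mono: "k \<le> l \<Longrightarrow> prefix (w k) (w l)"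
proof (induction l rule: int_ge_induct)
  case (step l)
  have "prefix (word_power (w l) 1) (w (l + 1))"
    using prefix_expansion_uword[of "l + 1"] t_1_pos expansion_params_Cons[of "l + 1"]
      prefix_word_power[of 1 "t 1" "w l"]
    by (metis add_diff_cancel_right' prefixI prefix_order.trans)
  then show ?case using step by (auto intro: prefix_order.trans)
qed simp

lemma is_prefix_square: "is_prefix (w (int k) @ w (int k))"
proof -
  have "2 \<le> t 1" using t_1_greater t_m_pos by linarith
  then have "prefix (word_power (w (int k)) 2) (E (int k + 1) params)"
    using prefix_word_power[of 2 "t 1" "w (int k)"] unfolding expansion_params_Cons
    by (simp add: prefix_order.trans[OF _ prefixI])
  then show ?thesis
    using is_prefix_expansion[of "k + 1"] is_prefix_prefix
    by (metis add.commute append.right_neutral numeral_2_eq_2 of_nat_Suc plus_1_eq_Suc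
        word_power_simps(1,2))
qed

text \<open>This form displays the period: u_{n-1}^{t 1} ... u_{n-m+1}^{t (m - 1)}, then the
  expansion of u_{n-m+1}. The form starting with u_n is \<open>Zword_eq\<close>.\<close>

definition Zword :: "nat \<Rightarrow> nat list" where
  "Zword n = E (int n) (map t [1..<m]) @ E (int n - int m + 1) params"

lemma uword_snoc:
  assumes "m \<le> n"
  shows "w (int n) = E (int n) (map t [1..<m]) @ word_power (w (int n - int m)) (t m)"
  using assms uword_eq[of "int n"] m_ge_2 unfolding params_snoc
  by (simp add: expansion_word_append algebra_simps)

text \<open>u_n ends in u_{n-m}^{t m}, which also starts the expansion of u_{n-m+1} as
  \<open>t m < t 1\<close>; taking it off there leaves the exponent
  \<open>t 1 - t m\<close>.\<close>

lemma Zword_eq: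
  assumes "m \<le> n"
  shows "Zword n = w (int n) @ E (int n - int m + 1) ((t 1 - t m) # map t [2..<m + 1])"
proof -
  have "word_power (w (int n - int m)) (t 1) =
      word_power (w (int n - int m)) (t m) @ word_power (w (int n - int m)) (t 1 - t m)"
    using t_1_greater by (simp flip: word_power_add)
  then show ?thesis
    unfolding Zword_def uword_snoc[OF assms] expansion_params_Cons by simp
qed

lemma length_Zword:
  assumes "m \<le> n" shows "length (Zword n) = Zlen m t n"
proof -
  have "map t [2..<m + 1] = map (\<lambda>i. t (i + 2)) [0..<m - 1]"
    using m_ge_2 by (intro nth_equalityI) (auto simp: add.commute)
  moreover have "[1..<m] = map Suc [0..<m - 1]"
    using m_ge_2 by (intro nth_equalityI) auto
  ultimately show ?thesis
    unfolding Zlen_def Zword_eq[OF assms]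
    by (simp add: expansion_word_map o_def algebra_simps)
qed

text \<open>The digits after u_n begin with \<open>t 1 - t m < t 1\<close>, so by the Parry
  condition they expand to a prefix of u_{n-m+1}, hence of u_n; the whole is a prefix of u_n
  u_n.\<close>

lemma is_prefix_Zword:
  assumes "m \<le> n" shows "is_prefix (Zword n)"
proof -
  let ?v = "(t 1 - t m) # map t [2..<m + 1]"
  have "lex_less (drop i ?v) params" if "i < length ?v" for i
    using that lex_less_params_suffix[of "i - 1"] lex_less_params_hd[of "t 1 - t m"] t_1_greater t_m_pos
    by (cases i) auto
  then have "prefix (E (int n - int m + 1) ?v) (w (int n - int m + 1))"
    by (rule prefix_expansion_lex_less)
  also have "prefix \<dots> (w (int n))" using m_ge_2 by (intro prefix_uword_mono) simp
  finally have "prefix (Zword n) (w (int n) @ w (int n))"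
    unfolding Zword_eq[OF assms] by simp
  then show ?thesis using is_prefix_square is_prefix_prefix by blast
qed

text \<open>Condition (1) settles every suffix except the single digit \<open>t (m - 1) + 1\<close>,
  which (2) bounds by \<open>t 1\<close>.\<close>

lemma lex_less_incremented_suffix:
  assumes "i < m - 2"
  shows "lex_less (drop i (map t [2..<m - 1] @ [t (m - 1) + 1])) params"
proof (cases "i < m - 3")
  case True
  then have "drop i (map t [2..<m - 1] @ [t (m - 1) + 1]) = map t [i + 2..<m - 1] @ [t (m - 1) + 1]"
    by (simp add: drop_map add.commute)
  then show ?thesis using lex_condition[of "i + 2"] True by simp
next
  case False
  then have drop: "drop i (map t [2..<m - 1] @ [t (m - 1) + 1]) = [t (m - 1) + 1]"
    using assms by simp
  show ?thesis
  proof (cases "t (m - 1) + 1 < t 1")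
    case True
    then show ?thesis unfolding drop by (rule lex_less_params_hd)
  next
    case eq: False
    \<comment> \<open>If that digit equals \<open>t 1\<close>, the next nonzero parameter decides;
      it exists because \<open>t m \<ge> 1\<close>, and the left side is zero there.\<close>
    define k where "k = (LEAST k. 1 \<le> k \<and> t (k + 1) > 0)"
    have "1 \<le> m - 1 \<and> t (m - 1 + 1) > 0" using m_ge_2 t_m_pos by simp
    then have k: "1 \<le> k \<and> t (k + 1) > 0" "k \<le> m - 1"
      unfolding k_def by (rule LeastI, rule Least_le)
    have zero: "t (i + 1) = 0" if "1 \<le> i" "i < k" for i
      using not_less_Least[of i "\<lambda>k. 1 \<le> k \<and> t (k + 1) > 0"] that by (simp add: k_def)
    have "zero_ext [t (m - 1) + 1] k < zero_ext params k"
      using k m_ge_2 by (simp add: zero_ext_def)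
    moreover have "zero_ext [t (m - 1) + 1] i = zero_ext params i" if "i < k" for i
      using that zero[of i] k m_ge_2 eq t_1_greater by (cases i) (auto simp: zero_ext_def)
    ultimately show ?thesis unfolding drop less_fun_def by blast
  qed
qed

text \<open>The final expansion fits into one more copy of u_{n-m+1}, which raises the digit
  \<open>t (m - 1)\<close> by one. So all that follows u_{n-1}^{t 1} is a prefix of u_{n-1}.\<close>

lemma period_Zword:
  assumes "m \<le> n" shows "prefix_period u (U (int n - 1)) (Zlen m t n)"
proof -
  let ?r = "E (int n - 1) (map t [2..<m]) @ E (int n - int m + 1) params"
  have "[1..<m] = 1 # [2..<m]" using m_ge_2 by (simp add: upt_conv_Cons numeral_2_eq_2)
  then have Z: "Zword n = word_power (w (int n - 1)) (t 1) @ ?r"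
    by (simp add: Zword_def)
  have "[2..<m] = [2..<m - 1] @ [m - 1]"
    using m_ge_3 upt_Suc_append[of 2 "m - 1"] by simp
  then have tail: "map t [2..<m] = map t [2..<m - 1] @ [t (m - 1)]" by simp
  have index: "int n - 1 - int (length (map t [2..<m - 1])) - 1 = int n - int m + 1"
    using m_ge_3 by simp
  have "E (int n - 1) (map t [2..<m - 1] @ [t (m - 1) + 1]) =
      E (int n - 1) (map t [2..<m]) @ w (int n - int m + 1)"
    unfolding tail expansion_word_append
    by (simp only: expansion_word.simps index word_power_Suc_right append_assoc append_Nil2
        Suc_eq_plus1[symmetric])
  then have "prefix ?r (E (int n - 1) (map t [2..<m - 1] @ [t (m - 1) + 1]))"
    using prefix_expansion_uword by simp
  also have "prefix \<dots> (w (int n - 1))"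
    using lex_less_incremented_suffix m_ge_3 by (intro prefix_expansion_lex_less) simp
  finally show ?thesis
    using prefix_period_power[of "w (int n - 1)" "t 1" ?r] is_prefix_Zword[OF assms] t_1_pos
    unfolding length_Zword[OF assms, symmetric] Z ulen_def by blast
qed

lemma U_le_Zlen: "m \<le> n \<Longrightarrow> U (int n) \<le> Zlen m t n"
  by (simp add: Zlen_def ulen_def)

text \<open>Z_n \<le> U_n + U_{n-m+1} \<le> 2 U_n \<le> U_{n+1}, so the induction can pass from Z_n
  on to U_{n+1}.\<close>

lemma Zlen_le_U:
  assumes "m \<le> n" shows "Zlen m t n \<le> U (int n + 1)"
proof -
  have "length (Zword n) + t m * U (int n - int m) =
      U (int n) + length (E (int n - int m + 1) params)"
    unfolding ulen_def uword_snoc[OF assms] Zword_def by simp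
  moreover have "length (E (int n - int m + 1) params) \<le> U (int n - int m + 1)"
    using length_expansion_params[of "int n - int m + 1"] by simp
  moreover have "U (int n - int m + 1) \<le> U (int n)" using m_ge_2 by (intro U_mono) simp
  ultimately show ?thesis using length_Zword[OF assms] U_double[of "int n"] by linarith
qed

section \<open>Passing from \<open>Gam m t (n - 1)\<close> to \<open>Gam m t n\<close>\<close>

lemma Gam_eq:
  assumes "m \<le> n + 1" shows "Gam m t n = (\<lambda>i. U (int i) - 1) ` {n + 1 - m..n}"
proof (cases "n \<le> m - 1")
  \<comment> \<open>Here \<open>n = m - 1\<close>: truncation would turn \<open>n - m + 1\<close>
    into 1, whereas \<open>n + 1 - m\<close> is the correct lower end 0.\<close>
  case True
  then have "n + 1 - m = 0" using m_ge_2 by simp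
  then show ?thesis using True by (simp add: Gam_def)
next
  case False
  then show ?thesis by (simp add: Gam_def Suc_diff_le)
qed

lemma U_in_Gam: "m \<le> n + 1 \<Longrightarrow> i \<in> {n + 1 - m..n} \<Longrightarrow> U (int i) - 1 \<in> Gam m t n"
  using Gam_eq[of n] by blast

lemma Gam_initial: "n < m \<Longrightarrow> Gam m t n = (\<lambda>i. U (int i) - 1) ` {..n}"
  by (simp add: Gam_def atLeast0AtMost)

text \<open>The position \<open>U (int n - 1) - 1\<close> that the period would add is already in
  the set.\<close>

lemma attractor_up_to_Z:
  assumes n: "m \<le> n" and attr: "string_attractor (Gam m t (n - 1)) (stake (U (int n)) u)"
    and l: "l \<in> {U (int n)..Zlen m t n}"
  shows "string_attractor (Gam m t (n - 1)) (stake l u)"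
proof -
  have "0 \<le> int n - 1" using n m_ge_2 by simp
  then have p: "1 \<le> U (int n - 1)" "U (int n - 1) < U (int n)"
    using U_pos[of "int n - 1"] U_less[of "int n - 1"] by simp_all
  have "int n - 1 = int (n - 1)" using n m_ge_2 by simp
  moreover have "U (int (n - 1)) - 1 \<in> Gam m t (n - 1)"
    using n m_ge_2 by (intro U_in_Gam) auto
  ultimately have "U (int n - 1) - 1 \<in> Gam m t (n - 1)" by metis
  moreover have "string_attractor (insert (U (int n - 1) - 1) (Gam m t (n - 1))) (stake l u)"
    using string_attractor_extend_period[OF attr prefix_period_mono[OF period_Zword[OF n]], of l] l p
    by auto
  ultimately show ?thesis by (simp only: insert_absorb)
qed

lemma attractor_at_Z:
  assumes n: "m \<le> n" and attr: "string_attractor (Gam m t (n - 1)) (stake (Zlen m t n) u)"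
  shows "string_attractor (Gam m t n) (stake (Zlen m t n) u)"
proof -
  let ?k = "int n - int m" and ?d = "length (E (int n - int m + 1) params)"
  have k: "?k = int (n - m)" "?k + 1 = int (n - m + 1)" using n by simp_all
  have U_n: "U (int n) = length (E (int n) (map t [1..<m])) + t m * U ?k"
    unfolding ulen_def uword_snoc[OF n] by simp
  have Z: "Zlen m t n = length (E (int n) (map t [1..<m])) + ?d"
    using length_Zword[OF n] by (simp add: Zword_def)
  show ?thesis
  \<comment> \<open>\<open>U ?k - 1\<close> is dropped; \<open>c\<close> is the next position, which
    is kept. The last block, of length \<open>?d\<close>, starts at
    \<open>U (int n) - t m * U ?k\<close>, so its \<open>t m\<close>-th period ends at the gained
    position \<open>U (int n) - 1\<close>.\<close>
  proof (rule string_attractor_exchange[where p = "U ?k" and c = "U (?k + 1) - 1" and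
        b = "U (int n)" and d = ?d and r = "t m", OF attr])
    have "{n - m..n - 1} \<subseteq> insert (n - m) {n + 1 - m..n}" by auto
    then show "Gam m t (n - 1) \<subseteq> insert (U ?k - 1) (Gam m t n)"
      using n m_ge_2 Gam_eq[of n] Gam_eq[of "n - 1"] unfolding k by auto
    show "U (?k + 1) - 1 \<in> Gam m t n"
      unfolding k(2) using n m_ge_2 by (intro U_in_Gam) auto
    show "U (int n) - 1 \<in> Gam m t n" using n m_ge_2 by (intro U_in_Gam) auto
    have "U (int i) - 1 < Zlen m t n" if "i \<le> n" for i
      using U_mono[of "int i" "int n"] U_pos[of "int i"] U_le_Zlen[OF n] that by linarith
    then show "Gam m t n \<subseteq> {0..<Zlen m t n}" using n Gam_eq[of n] by auto
    show "prefix_period u (U ?k) ?d" unfolding k(1) by (rule period_expansion_params)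
    show "1 \<le> U ?k" using n by (intro U_pos) simp
    show "U ?k \<le> U (?k + 1) - 1" using n U_less[of ?k] by simp
    show "U (?k + 1) - 1 \<le> ?d" using length_expansion_params[of "?k + 1"] by simp
    \<comment> \<open>The block starts with u_{n-m}^{t 1}; \<open>t m < t 1\<close> leaves a full
      period after the \<open>t m\<close>-th.\<close>
    have "(t m + 1) * U ?k \<le> t 1 * U ?k" using t_1_greater by (intro mult_le_mono1) simp
    also have "\<dots> \<le> ?d" unfolding expansion_params_Cons by (simp add: ulen_def)
    finally show "(t m + 1) * U ?k \<le> ?d" .
    show "1 \<le> t m" by (rule t_m_pos)
    show "t m * U ?k \<le> U (int n)" using U_n by simp
    show "U (int n) - t m * U ?k + ?d \<le> Zlen m t n" using U_n Z by simp
    fix i assume i: "i < ?d"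
    have "u !! (length (E (int n) (map t [1..<m])) + i) = E (?k + 1) params ! i"
      using is_prefix_nth[OF is_prefix_Zword[OF n], of "length (E (int n) (map t [1..<m])) + i"] i
      by (simp add: Zword_def)
    also have "\<dots> = u !! i"
      using is_prefix_nth[OF is_prefix_expansion[of "n - m + 1"], of i] i k(2) by metis
    finally show "u !! (U (int n) - t m * U ?k + i) = u !! i" using U_n by simp
  qed
qed

text \<open>Now the period is \<open>U n\<close>, and \<open>U n - 1\<close> is already in the set.
  As \<open>n \<ge> m\<close>, the expansion of u_{n+1} is the whole word, so length
  \<open>U (n + 1)\<close> is included.\<close>

lemma attractor_from_Z:
  assumes n: "m \<le> n" and attr: "string_attractor (Gam m t n) (stake (Zlen m t n) u)"
    and l: "l \<in> {Zlen m t n..U (int n + 1)}"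
  shows "string_attractor (Gam m t n) (stake l u)"
proof -
  have "length (E (int n + 1) params) = U (int n + 1)"
    using n length_expansion_params[of "int n + 1"] by simp
  then have "prefix_period u (U (int n)) l"
    using prefix_period_mono[OF period_expansion_params[of n]] l by simp
  moreover have "U (int n) - 1 \<in> Gam m t n" using n m_ge_2 by (intro U_in_Gam) auto
  moreover have "1 \<le> U (int n)" by (rule U_pos) simp
  ultimately show ?thesis
    using string_attractor_extend_period[OF attr, of "U (int n)" l] l U_le_Zlen[OF n]
    by (auto simp: insert_absorb)
qed

text \<open>Each step runs from U_n to Z_n, exchanges a position there, and continues to U_{n+1}.
  The base U_m is the last length reached from \<open>n = m - 1\<close> in
  \<open>attractor_initial\<close>.\<close>

lemma attractor_at_U:
  assumes "m \<le> n"
  shows "string_attractor (Gam m t (n - 1)) (stake (U (int n)) u)"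
  using assms
proof (induction n rule: dec_induct)
  case base
  have "int (m - 1) + 1 = int m" using m_ge_2 by simp
  then show ?case
    using attractor_initial[of "m - 1" "U (int m)"] U_mono[of "int (m - 1)" "int m"]
      length_expansion_params[of "int m"] Gam_initial[of "m - 1"] m_ge_2 by simp
next
  case (step n)
  have "string_attractor (Gam m t (n - 1)) (stake (Zlen m t n) u)"
    using attractor_up_to_Z[OF step(1) step(3)] U_le_Zlen[OF step(1)] by simp
  then show ?case
    using attractor_from_Z[OF step(1) attractor_at_Z[OF step(1)], of "U (int n + 1)"]
      Zlen_le_U[OF step(1)]
    by (simp add: add.commute)
qed

end

theorem theorem4p19:
  fixes m :: nat and t :: "nat \<Rightarrow> nat" and u :: "nat stream"
  assumes "simple_Parry m t"
    and "Parry_sequence m t u"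
    and "\<forall>i\<in>{2..m - 2}.
           lex_less (map t [i..<m - 1] @ [t (m - 1) + 1]) (map t [1..<m + 1])"
    and "t 1 > max (t (m - 1)) (t m)"
  shows "(\<forall>n::nat. n \<le> m - 1 \<longrightarrow>
            (\<forall>l\<in>{ulen m t (int n)..ulen m t (int n + 1) - 1}.
               string_attractor (Gam m t n) (stake l u))) \<and>
         (\<forall>n::nat. n \<ge> m \<longrightarrow>
            (\<forall>l\<in>{ulen m t (int n)..Zlen m t n}.
               string_attractor (Gam m t (n - 1)) (stake l u))) \<and>
         (\<forall>n::nat. n \<ge> m \<longrightarrow>
            (\<forall>l\<in>{Zlen m t n..ulen m t (int n + 1)}.
               string_attractor (Gam m t n) (stake l u)))"
proof -
  interpret Parry_attractor m t u
    using assms by unfold_locales auto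
  show ?thesis
  proof (intro conjI allI impI ballI)
    fix n l assume n: "n \<le> m - 1" and l: "l \<in> {U (int n)..U (int n + 1) - 1}"
    have "n < m" using n m_ge_2 by simp
    \<comment> \<open>The expansion has length \<open>U (n + 1) - 1\<close> if
      \<open>n + 1 < m\<close>, and \<open>U m\<close> if \<open>n = m - 1\<close>.\<close>
    moreover have "l \<in> {U (int n)..length (E (int n + 1) params)}"
      using l length_expansion_params[of "int n + 1"] by (auto split: if_splits)
    ultimately show "string_attractor (Gam m t n) (stake l u)"
      using attractor_initial Gam_initial by simp
  next
    fix n l assume n: "m \<le> n" and l: "l \<in> {U (int n)..Zlen m t n}"
    then show "string_attractor (Gam m t (n - 1)) (stake l u)"
      using attractor_up_to_Z attractor_at_U by blast
  next
    fix n l assume n: "m \<le> n" and l: "l \<in> {Zlen m t n..U (int n + 1)}"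
    have "string_attractor (Gam m t (n - 1)) (stake (Zlen m t n) u)"
      using attractor_up_to_Z[OF n attractor_at_U[OF n]] U_le_Zlen[OF n] by simp
    then show "string_attractor (Gam m t n) (stake l u)"
      using attractor_from_Z[OF n attractor_at_Z[OF n]] l by blast
  qed
qed

end
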